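(* Let $k$ and $n$ be positive integers and let $P$ be a $(kn,n)$-Dyck path. Let $\sigma=(\sigma_1,\dots,\sigma_{kn+n})$ be the output sequence of the sweep map applied from right to left to $P$, and $\tau=(\tau_1,\dots,\tau_{kn+n})$ the corresponding sequence of levels. If $\sigma_i=\mathrm{W}$ has level $\tau_i=mn$ and $\sigma_{i+1}=\mathrm{S}$, then $\tau_{i+1}=mn$ as well. Moreover, if in addition $\sigma_{i+2}=\mathrm{S}$, then $\tau_{i+2}=mn$ also.
   Context: A $(kn,n)$-Dyck path is a lattice path from $(0,0)$ to $(kn,n)$ consisting of $kn$ unit east steps and $n$ unit north steps that never passes below the line $y=x/k$. The level of a lattice point $(x,y)$ is $kn\cdot y-n\cdot x$; thus the path stays at levels $\ge 0$, a north step raises the level by $kn$ and an east step lowers it by $n$. Each step is recorded by its starting point: a north step is recorded as S (its south endpoint) and an east step as W (its west endpoint); the level of a step is the level of its starting point. The sweep map applied from right to left lists all $kn+n$ steps in order of nondecreasing level, where among steps of equal level the one occurring later along the path (further to the right) is listed first. The output sequence $\sigma$ is the resulting word in the letters S and W, and $\tau_j$ is the level of the step listed in position $j$ (so $\tau$ is nondecreasing). *)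

theory Defs
  imports Complex_Main
begin

datatype step = North | East

datatype letter = S | W

fun letter_of :: "step \<Rightarrow> letter" where
  "letter_of North = S"
| "letter_of East = W"

text \<open>\<open>vertex P j\<close> is the lattice point reached after the first \<open>j\<close> steps, that is, the
  starting point of the step \<open>P ! j\<close>.\<close>

definition vertex :: "step list \<Rightarrow> nat \<Rightarrow> nat \<times> nat" where
  "vertex P j = (count_list (take j P) East, count_list (take j P) North)"

definition dyck_path :: "nat \<Rightarrow> nat \<Rightarrow> step list \<Rightarrow> bool" where
  "dyck_path k n P \<longleftrightarrow>
     count_list P East = k * n \<and> count_list P North = n \<and>
     (\<forall>j\<le>length P. case vertex P j of (x, y) \<Rightarrow> real y \<ge> real x / real k)"

definition level :: "nat \<Rightarrow> nat \<Rightarrow> nat \<times> nat \<Rightarrow> int" where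
  "level k n = (\<lambda>(x, y). int (k * n) * int y - int n * int x)"

definition step_level :: "nat \<Rightarrow> nat \<Rightarrow> step list \<Rightarrow> nat \<Rightarrow> int" where
  "step_level k n P j = level k n (vertex P j)"

text \<open>\<open>sort_key\<close> is stable, so starting from the decreasing list of positions puts, among
  steps of equal level, the one occurring later along the path first.\<close>

definition sweep_order :: "nat \<Rightarrow> nat \<Rightarrow> step list \<Rightarrow> nat list" where
  "sweep_order k n P = sort_key (step_level k n P) (rev [0..<length P])"

definition sweep_word :: "nat \<Rightarrow> nat \<Rightarrow> step list \<Rightarrow> letter list" where
  "sweep_word k n P = map (\<lambda>j. letter_of (P ! j)) (sweep_order k n P)"

definition sweep_levels :: "nat \<Rightarrow> nat \<Rightarrow> step list \<Rightarrow> int list" where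
  "sweep_levels k n P = map (step_level k n P) (sweep_order k n P)"

end

theory Submission
  imports Defs
begin

text \<open>Dividing levels by \<open>n\<close>, a north step goes up by \<open>k\<close> and an east step goes down by exactly
  \<open>1\<close>. So after a north step from a positive height the path, which ends at height \<open>0\<close>, must come
  back to that height: at every positive level the rightmost step is an east step. Whenever the
  level jumps up in the sweep order, the first step listed at the new level is the rightmost one
  there, hence a \<open>W\<close>; an \<open>S\<close> following a listed step therefore has the same level.\<close>

lemma int_intermed_val_if_decrease_le_1:
  fixes h :: "nat \<Rightarrow> int"
  assumes "a \<le> b" and decrease: "\<And>q. a \<le> q \<Longrightarrow> q < b \<Longrightarrow> h q - 1 \<le> h (Suc q)"
    and "v \<le> h a" and "h b < v"
  shows "\<exists>q. a \<le> q \<and> q < b \<and> h q = v"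
proof -
  have "\<exists>d<b - a. (\<forall>i\<le>d. \<not> h (a + i) < v) \<and> h (a + Suc d) < v"
    using assms by (intro ex_least_nat_less) auto
  then obtain d where "d < b - a" and above: "v \<le> h (a + d)" and below: "h (Suc (a + d)) < v"
    by force
  then have "a + d < b" by simp
  moreover have "h (a + d) = v"
    using decrease[of "a + d"] \<open>a + d < b\<close> above below by simp
  ultimately show ?thesis by (intro exI[of _ "a + d"]) simp
qed

lemma sorted_wrt_insort_key:
  assumes "sorted_wrt (\<lambda>x y. f x < f y \<or> f x = f y \<and> R x y) ys" and "\<forall>y\<in>set ys. R x y"
  shows "sorted_wrt (\<lambda>x y. f x < f y \<or> f x = f y \<and> R x y) (insort_key f x ys)"
  using assms by (induction ys) (auto simp: set_insort_key)

lemma sorted_wrt_sort_key: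
  assumes "sorted_wrt R xs"
  shows "sorted_wrt (\<lambda>x y. f x < f y \<or> f x = f y \<and> R x y) (sort_key f xs)"
  using assms by (induction xs) (simp_all add: sorted_wrt_insort_key)

lemma sorted_wrt_adjacent:
  assumes "sorted_wrt R xs" and "Suc i < length xs" and "x \<in> set xs"
  shows "R x (xs ! i) \<or> x = xs ! i \<or> x = xs ! Suc i \<or> R (xs ! Suc i) x"
proof -
  obtain p where p: "p < length xs" "x = xs ! p"
    using assms(3) by (auto simp: in_set_conv_nth)
  consider "p < i" | "p = i" | "p = Suc i" | "Suc i < p" by linarith
  then show ?thesis
    using p assms(2) by cases (auto intro: sorted_wrt_nth_less[OF assms(1)])
qed

definition height :: "nat \<Rightarrow> step list \<Rightarrow> nat \<Rightarrow> int" where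
  "height k P j = int k * int (count_list (take j P) North) - int (count_list (take j P) East)"

lemma step_level_eq_height: "step_level k n P j = int n * height k P j"
  by (simp add: step_level_def level_def vertex_def height_def algebra_simps)

lemma height_Suc:
  assumes "j < length P"
  shows "height k P (Suc j) = (if P ! j = North then height k P j + int k else height k P j - 1)"
  using assms by (cases "P ! j") (auto simp: height_def take_Suc_conv_app_nth algebra_simps)

lemma north_step_height_recurs:
  assumes "j < length P" and "P ! j = North" and "height k P (length P) < height k P j"
  shows "\<exists>q>j. q < length P \<and> height k P q = height k P j"
proof -
  have "height k P j \<le> height k P (Suc j)"
    using assms(1,2) by (simp add: height_Suc)
  then have "\<exists>q. Suc j \<le> q \<and> q < length P \<and> height k P q = height k P j"
    using assms(1,3) by (intro int_intermed_val_if_decrease_le_1) (auto simp: height_Suc)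
  then show ?thesis by (auto simp: Suc_le_eq)
qed

lemma length_dyck_path:
  assumes "dyck_path k n P"
  shows "length P = k * n + n"
proof -
  have "set P \<subseteq> {East, North}"
    using step.exhaust by blast
  then have "length P = count_list P East + count_list P North"
    using sum_count_set[of P "{East, North}"] by simp
  with assms show ?thesis by (simp add: dyck_path_def)
qed

lemma height_dyck_path_end:
  assumes "dyck_path k n P"
  shows "height k P (length P) = 0"
  using assms by (simp add: height_def dyck_path_def)

lemma height_dyck_path_nonneg:
  assumes "dyck_path k n P" and "k > 0" and "j \<le> length P"
  shows "0 \<le> height k P j"
proof -
  let ?x = "count_list (take j P) East" and ?y = "count_list (take j P) North"
  have "real ?x / real k \<le> real ?y"
    using assms by (auto simp: dyck_path_def vertex_def)
  with \<open>k > 0\<close> have "real ?x \<le> real (k * ?y)"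
    by (simp add: field_simps)
  then have "int ?x \<le> int (k * ?y)"
    by linarith
  then show ?thesis by (simp add: height_def)
qed

lemma north_step_level_recurs:
  assumes "dyck_path k n P" and "j < length P" and "P ! j = North" and "0 < step_level k n P j"
  shows "\<exists>q>j. q < length P \<and> step_level k n P q = step_level k n P j"
proof -
  have "0 < height k P j"
    using assms(4) by (auto simp: step_level_eq_height zero_less_mult_iff)
  then have "\<exists>q>j. q < length P \<and> height k P q = height k P j"
    using assms(2,3) by (intro north_step_height_recurs)
      (simp_all add: height_dyck_path_end[OF assms(1)])
  then show ?thesis by (auto simp: step_level_eq_height)
qed

definition sweep_before :: "nat \<Rightarrow> nat \<Rightarrow> step list \<Rightarrow> nat \<Rightarrow> nat \<Rightarrow> bool" where
  "sweep_before k n P a b \<longleftrightarrow>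
     step_level k n P a < step_level k n P b \<or> step_level k n P a = step_level k n P b \<and> b < a"

lemma sorted_wrt_sweep_order: "sorted_wrt (sweep_before k n P) (sweep_order k n P)"
proof -
  have "sorted_wrt (>) (rev [0..<length P])"
    by (simp add: sorted_wrt_rev)
  from sorted_wrt_sort_key[OF this, of "step_level k n P"] show ?thesis
    by (simp add: sweep_order_def sweep_before_def[abs_def])
qed

lemma set_sweep_order: "set (sweep_order k n P) = {..<length P}"
  by (auto simp: sweep_order_def)

lemma length_sweep_order: "length (sweep_order k n P) = length P"
  by (simp add: sweep_order_def)

lemma sweep_order_north_level_eq_previous:
  fixes k n i :: nat and P :: "step list"
  defines "a \<equiv> sweep_order k n P ! i" and "b \<equiv> sweep_order k n P ! Suc i"
  assumes dyck: "dyck_path k n P" and "k > 0" and "Suc i < length P" and "P ! b = North"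
  shows "step_level k n P b = step_level k n P a"
proof (rule ccontr)
  assume "step_level k n P b \<noteq> step_level k n P a"
  moreover have "sweep_before k n P a b"
    unfolding a_def b_def using \<open>Suc i < length P\<close>
    by (intro sorted_wrt_nth_less[OF sorted_wrt_sweep_order]) (simp_all add: length_sweep_order)
  ultimately have jump: "step_level k n P a < step_level k n P b"
    by (auto simp: sweep_before_def)
  have "a \<in> set (sweep_order k n P)" and "b \<in> set (sweep_order k n P)"
    using \<open>Suc i < length P\<close> by (simp_all add: a_def b_def length_sweep_order)
  then have "a < length P" and "b < length P"
    by (simp_all add: set_sweep_order)
  have "0 \<le> step_level k n P a"
    using height_dyck_path_nonneg[OF dyck \<open>k > 0\<close>] \<open>a < length P\<close>
    by (simp add: step_level_eq_height)
  with jump obtain c where c: "b < c" "c < length P" "step_level k n P c = step_level k n P b"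
    using north_step_level_recurs[OF dyck \<open>b < length P\<close> \<open>P ! b = North\<close>] by auto
  have "sweep_before k n P c a \<or> c = a \<or> c = b \<or> sweep_before k n P b c"
    unfolding a_def b_def using \<open>Suc i < length P\<close> \<open>c < length P\<close>
    by (intro sorted_wrt_adjacent[OF sorted_wrt_sweep_order])
      (simp_all add: length_sweep_order set_sweep_order)
  with c jump show False by (auto simp: sweep_before_def)
qed

lemma sweep_S_level_eq_previous:
  assumes "dyck_path k n P" and "k > 0" and "Suc i < length P"
    and "sweep_word k n P ! Suc i = S"
  shows "sweep_levels k n P ! Suc i = sweep_levels k n P ! i"
proof -
  have "P ! (sweep_order k n P ! Suc i) = North"
    using assms(3,4)
    by (cases "P ! (sweep_order k n P ! Suc i)") (simp_all add: sweep_word_def length_sweep_order)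
  with assms(1-3) show ?thesis
    by (simp add: sweep_levels_def length_sweep_order sweep_order_north_level_eq_previous)
qed

theorem theorem2p1:
  fixes k n i :: nat and m :: int and P :: "step list"
    and \<sigma> :: "letter list" and \<tau> :: "int list"
  assumes "k > 0" and "n > 0"
    and "dyck_path k n P"
    and "\<sigma> = sweep_word k n P" and "\<tau> = sweep_levels k n P"
    and "i + 1 < k * n + n"
    and "\<sigma> ! i = W" and "\<tau> ! i = m * int n"
    and "\<sigma> ! (i + 1) = S"
  shows "\<tau> ! (i + 1) = m * int n \<and>
    (i + 2 < k * n + n \<and> \<sigma> ! (i + 2) = S \<longrightarrow> \<tau> ! (i + 2) = m * int n)"
proof -
  have level_eq: "\<tau> ! Suc q = \<tau> ! q" if "Suc q < k * n + n" "\<sigma> ! Suc q = S" for q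
    using sweep_S_level_eq_previous[OF assms(3,1)] that length_dyck_path[OF assms(3)] assms(4,5)
    by simp
  show ?thesis
    using level_eq[of i] level_eq[of "Suc i"] assms(6,8,9) by auto
qed

end
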